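(* Let $u:\mathbb{C}^{11}\to\mathbb{R}$ be the function $$u(z_1,\dots,z_{11})=-\sum_{j=1}^{2}|z_j|^2+2\sum_{j=3}^{11}|z_j|^2.$$ Then $i\partial\bar\partial u\wedge(i\partial\bar\partial\|z\|^2)^{2}\geq 0$ and $(i\partial\bar\partial u)^{9}\wedge(i\partial\bar\partial\|z\|^2)^{2}\geq 0$, but $(i\partial\bar\partial u)^{8}\wedge(i\partial\bar\partial\|z\|^2)^{3}<0$. In particular, $u$ is A-$3$-subharmonic but not B-$3$-subharmonic.
   Context: For a real-valued $u\in\mathcal{C}^2(\Omega)$ with $\Omega\subset\mathbb{C}^n$, let $\lambda_1(z)\le\dots\le\lambda_n(z)$ be the eigenvalues of the complex Hessian $\left(\frac{\partial^2u}{\partial z_p\partial\bar z_q}(z)\right)_{p,q=1}^n$ and let $\sigma_j$ be the $j$-th elementary symmetric polynomial. The form inequality $i\partial\bar\partial u\wedge (i\partial\bar\partial\|z\|^2)^{k-1}\geq 0$ (positivity of a $(k,k)$-form) means that the sum of any $k$ eigenvalues $\lambda_j(z)$ is nonnegative at every point ($u$ is then called $k$-plurisubharmonic). The inequality $(i\partial\bar\partial u)^{j}\wedge (i\partial\bar\partial\|z\|^2)^{n-j}\geq 0$ (respectively $<0$) of top-degree forms means $\sigma_j(\lambda(z))\ge 0$ (respectively $<0$) at every point. For $1\le m\le n$, $u$ is A-$m$-subharmonic if it is $m$-plurisubharmonic and $(i\partial\bar\partial u)^{n-m+1}\wedge (i\partial\bar\partial\|z\|^2)^{m-1}\geq 0$.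 It is B-$m$-subharmonic if $(i\partial\bar\partial u)^{j}\wedge (i\partial\bar\partial\|z\|^2)^{n-j}\geq 0$ for every $j=1,\dots,n-m+1$. *)

theory Defs
  imports "HOL-Analysis.Analysis" "HOL-Computational_Algebra.Polynomial" "HOL-Library.Multiset"
begin

definition C2_on :: "('a::real_normed_vector) set \<Rightarrow> ('a \<Rightarrow> real) \<Rightarrow> bool" where
  "C2_on \<Omega> u \<longleftrightarrow>
     (\<exists>(u' :: 'a \<Rightarrow> 'a \<Rightarrow>\<^sub>L real) (u'' :: 'a \<Rightarrow> 'a \<Rightarrow>\<^sub>L ('a \<Rightarrow>\<^sub>L real)).
        (\<forall>z\<in>\<Omega>. (u has_derivative blinfun_apply (u' z)) (at z)) \<and>
        (\<forall>z\<in>\<Omega>. (u' has_derivative blinfun_apply (u'' z)) (at z)) \<and>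
        continuous_on \<Omega> u'')"

definition dir_deriv :: "complex^'n \<Rightarrow> (complex^'n \<Rightarrow> complex) \<Rightarrow> complex^'n \<Rightarrow> complex" where
  "dir_deriv v f z = vector_derivative (\<lambda>t::real. f (z + t *\<^sub>R v)) (at 0)"

text \<open>The Wirtinger operators \<open>\<partial>/\<partial>z\<^sub>p = (\<partial>/\<partial>x\<^sub>p - \<i> \<partial>/\<partial>y\<^sub>p)/2\<close> and
  \<open>\<partial>/\<partial>\<bar>z\<^sub>q = (\<partial>/\<partial>x\<^sub>q + \<i> \<partial>/\<partial>y\<^sub>q)/2\<close>, where \<open>z\<^sub>p = x\<^sub>p + \<i> y\<^sub>p\<close>.\<close>

definition wirtinger :: "'n::finite \<Rightarrow> (complex^'n \<Rightarrow> complex) \<Rightarrow> complex^'n \<Rightarrow> complex" where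
  "wirtinger p f z = (dir_deriv (axis p 1) f z - \<i> * dir_deriv (axis p \<i>) f z) / 2"

definition wirtinger_bar :: "'n::finite \<Rightarrow> (complex^'n \<Rightarrow> complex) \<Rightarrow> complex^'n \<Rightarrow> complex" where
  "wirtinger_bar q f z = (dir_deriv (axis q 1) f z + \<i> * dir_deriv (axis q \<i>) f z) / 2"

definition complex_hessian :: "(complex^'n::finite \<Rightarrow> real) \<Rightarrow> complex^'n \<Rightarrow> complex^'n^'n" where
  "complex_hessian u z =
     (\<chi> p q. wirtinger p (wirtinger_bar q (\<lambda>w. complex_of_real (u w))) z)"

definition charpoly :: "complex^'n^'n \<Rightarrow> complex poly" where
  "charpoly A = det (\<chi> i j. (if i = j then [:0, 1:] else 0) - [:A $ i $ j:])"

lemma poly_charpoly_eq_0_iff: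
  "poly (charpoly A) x = 0 \<longleftrightarrow> (\<exists>v. v \<noteq> 0 \<and> A *v v = x *s v)"
proof -
  let ?B = "mat x - A"
  have "poly (charpoly A) x =
      det (\<chi> i j. poly ((if i = j then [:0, 1:] else 0) - [:A $ i $ j:]) x)"
    by (simp add: charpoly_def det_def poly_sum poly_prod)
  also have "(\<chi> i j. poly ((if i = j then [:0, 1:] else 0) - [:A $ i $ j:]) x) = ?B"
    by (simp add: vec_eq_iff mat_def)
  finally have "poly (charpoly A) x = 0 \<longleftrightarrow> \<not> invertible ?B"
    by (simp add: invertible_det_nz)
  also have "\<dots> \<longleftrightarrow> (\<exists>v. v \<noteq> 0 \<and> ?B *v v = 0)"
    by (auto simp: invertible_left_inverse matrix_left_invertible_ker)
  also have "\<dots> \<longleftrightarrow> (\<exists>v. v \<noteq> 0 \<and> A *v v = x *s v)"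
  proof -
    have "mat x *v v = x *s v" for v :: "complex^'a"
      by (simp add: vec_eq_iff matrix_vector_mult_def mat_def if_distrib if_distribR cong: if_cong)
    then show ?thesis
      by (auto simp: matrix_vector_mult_diff_rdistrib)
  qed
  finally show ?thesis .
qed

text \<open>The eigenvalues of a Hermitian matrix, repeated according to multiplicity and in increasing
  order; taking \<^const>\<open>Re\<close> is harmless because they are real. The complex Hessian of a real-valued
  \<open>C\<^sup>2\<close> function is Hermitian.\<close>

definition hermitian_eigenvalues :: "complex^'n^'n \<Rightarrow> real list" where
  "hermitian_eigenvalues A = sorted_list_of_multiset (image_mset Re (proots (charpoly A)))"

definition hessian_eigenvalue ::
    "(complex^'n::finite \<Rightarrow> real) \<Rightarrow> nat \<Rightarrow> complex^'n \<Rightarrow> real" where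
  "hessian_eigenvalue u j z = hermitian_eigenvalues (complex_hessian u z) ! (j - 1)"

definition elem_sym :: "nat \<Rightarrow> nat \<Rightarrow> (nat \<Rightarrow> real) \<Rightarrow> real" where
  "elem_sym n j x = (\<Sum>S | S \<subseteq> {1..n} \<and> card S = j. \<Prod>i\<in>S. x i)"

text \<open>\<open>\<i>\<partial>\<bar>\<partial>u \<and> (\<i>\<partial>\<bar>\<partial>\<parallel>z\<parallel>\<^sup>2)\<^bsup>k-1\<^esup> \<ge> 0\<close> on \<open>\<Omega>\<close>.\<close>

definition form_kk_nonneg :: "(complex^'n::finite) set \<Rightarrow> nat \<Rightarrow> (complex^'n \<Rightarrow> real) \<Rightarrow> bool" where
  "form_kk_nonneg \<Omega> k u \<longleftrightarrow>
     (\<forall>z\<in>\<Omega>. \<forall>S. S \<subseteq> {1..CARD('n)} \<and> card S = k \<longrightarrow> 0 \<le> (\<Sum>j\<in>S. hessian_eigenvalue u j z))"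

text \<open>\<open>(\<i>\<partial>\<bar>\<partial>u)\<^sup>j \<and> (\<i>\<partial>\<bar>\<partial>\<parallel>z\<parallel>\<^sup>2)\<^bsup>n-j\<^esup> \<ge> 0\<close>, respectively \<open>< 0\<close>, on \<open>\<Omega>\<close>.\<close>

definition form_top_nonneg :: "(complex^'n::finite) set \<Rightarrow> nat \<Rightarrow> (complex^'n \<Rightarrow> real) \<Rightarrow> bool" where
  "form_top_nonneg \<Omega> j u \<longleftrightarrow>
     (\<forall>z\<in>\<Omega>. 0 \<le> elem_sym CARD('n) j (\<lambda>i. hessian_eigenvalue u i z))"

definition form_top_neg :: "(complex^'n::finite) set \<Rightarrow> nat \<Rightarrow> (complex^'n \<Rightarrow> real) \<Rightarrow> bool" where
  "form_top_neg \<Omega> j u \<longleftrightarrow>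
     (\<forall>z\<in>\<Omega>. elem_sym CARD('n) j (\<lambda>i. hessian_eigenvalue u i z) < 0)"

definition k_plurisubharmonic ::
    "(complex^'n::finite) set \<Rightarrow> nat \<Rightarrow> (complex^'n \<Rightarrow> real) \<Rightarrow> bool" where
  "k_plurisubharmonic \<Omega> k u \<longleftrightarrow>
     open \<Omega> \<and> C2_on \<Omega> u \<and> 1 \<le> k \<and> k \<le> CARD('n) \<and> form_kk_nonneg \<Omega> k u"

definition A_subharmonic ::
    "(complex^'n::finite) set \<Rightarrow> nat \<Rightarrow> (complex^'n \<Rightarrow> real) \<Rightarrow> bool" where
  "A_subharmonic \<Omega> m u \<longleftrightarrow>
     k_plurisubharmonic \<Omega> m u \<and> form_top_nonneg \<Omega> (CARD('n) - m + 1) u"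

definition B_subharmonic ::
    "(complex^'n::finite) set \<Rightarrow> nat \<Rightarrow> (complex^'n \<Rightarrow> real) \<Rightarrow> bool" where
  "B_subharmonic \<Omega> m u \<longleftrightarrow>
     open \<Omega> \<and> C2_on \<Omega> u \<and> 1 \<le> m \<and> m \<le> CARD('n) \<and>
     (\<forall>j\<in>{1..CARD('n) - m + 1}. form_top_nonneg \<Omega> j u)"

text \<open>The coordinate \<open>z\<^sub>j\<close> of a point of \<open>\<complex>\<^sup>1\<^sup>1\<close>, \<open>1 \<le> j \<le> 11\<close>, is \<open>z $ of_nat j\<close>: the index type
  \<open>11\<close> is the ring of integers modulo 11, so \<open>of_nat\<close> is a bijection from \<open>{1..11}\<close> onto it
  (with \<open>11\<close> sent to \<open>0\<close>).\<close>

text \<open>The index type \<open>11\<close> is the ring of integers modulo 11, so the coordinate \<open>z\<^sub>j\<close> of a point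
  of \<open>\<complex>\<^sup>1\<^sup>1\<close>, \<open>1 \<le> j \<le> 11\<close>, is written \<open>z $ of_nat j\<close> (with \<open>11\<close> sent to \<open>0\<close>).\<close>

lemma bij_betw_of_nat_11: "bij_betw (of_nat :: nat \<Rightarrow> 11) {1..11} UNIV"
proof -
  have "inj_on (of_nat :: nat \<Rightarrow> 11) {1..11}"
  proof (rule linorder_inj_onI)
    fix i j :: nat
    assume ij: "i < j" "i \<in> {1..11}" "j \<in> {1..11}"
    show "(of_nat i :: 11) \<noteq> of_nat j"
    proof
      assume "(of_nat i :: 11) = of_nat j"
      then have "(of_nat (j - i) :: 11) = 0"
        using ij by (simp add: of_nat_diff)
      then have "11 dvd j - i"
        by (simp add: of_nat_eq_0_iff_char_dvd)
      with ij show False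
        by (auto dest: dvd_imp_le)
    qed
  qed auto
  moreover from this have "(of_nat :: nat \<Rightarrow> 11) ` {1..11} = UNIV"
    by (intro card_subset_eq) (simp_all add: card_image)
  ultimately show ?thesis
    by (simp add: bij_betw_def)
qed

end

theory Submission
  imports Defs
begin

text \<open>
  The function is a diagonal form \<open>\<Sum>\<^sub>p a\<^sub>p \<bar>z\<^sub>p\<bar>\<^sup>2\<close>. Since \<open>\<partial>\<bar>z\<bar>\<^sup>2/\<partial>\<bar>z = z\<close>, its complex Hessian
  is the constant diagonal matrix with entries \<open>a\<^sub>p\<close> (\<open>complex_hessian_diag_form\<close>), so at every
  point the eigenvalues are the sorted weights (\<open>hermitian_eigenvalues_diag_form\<close>): here \<open>-1\<close>
  twice and \<open>2\<close> nine times. The theorem thereby becomes a statement about eleven numbers.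

  Three of them always include a \<open>2\<close>, which outweighs the at most two entries \<open>-1\<close>; this gives
  the positivity of the first form. The elementary symmetric polynomials are the coefficients of
  \<open>\<Prod>\<^sub>i (1 + \<lambda>\<^sub>i X) = (1 - X)\<^sup>2 (1 + 2X)\<^sup>9\<close> (\<open>elem_sym_eq_coeff\<close>), and there
  \<open>\<sigma>\<^sub>9 = 512\<close> but \<open>\<sigma>\<^sub>8 = -1536\<close> (\<open>elem_sym_11\<close>). With \<open>n = 11\<close> and \<open>m = 3\<close>, the
  definition of A-subharmonicity involves \<open>\<sigma>\<^sub>9\<close> alone among the \<open>\<sigma>\<^sub>j\<close>, whereas that of
  B-subharmonicity requires \<open>\<sigma>\<^sub>8 \<ge> 0\<close> as well.
\<close>

definition diag_form :: "('n::finite \<Rightarrow> real) \<Rightarrow> complex^'n \<Rightarrow> real" where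
  "diag_form a z = (\<Sum>p\<in>UNIV. a p * (cmod (z $ p))\<^sup>2)"

text \<open>
  The form is \<open>L z \<bullet> z / 2\<close> for a self-adjoint \<open>L\<close>, so its derivative at \<open>z\<close> is \<open>L z \<bullet> _\<close>. This
  depends linearly on \<open>z\<close>, and hence the second derivative is constant.
\<close>

lemma C2_on_diag_form:
  fixes a :: "'n::finite \<Rightarrow> real"
  shows "C2_on UNIV (diag_form a)"
proof -
  define L :: "complex^'n \<Rightarrow> complex^'n" where "L z = (\<chi> p. (2 * a p) *\<^sub>R z $ p)" for z
  have "linear L"
    by (rule linearI) (simp_all add: L_def vec_eq_iff algebra_simps)
  then have L: "bounded_linear L"
    by (rule linear_conv_bounded_linear[THEN iffD1])
  have sym: "L x \<bullet> y + L y \<bullet> x = 2 * (L x \<bullet> y)" for x y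
    by (simp add: L_def inner_vec_def inner_commute)
  have form: "diag_form a = (\<lambda>z. (L z \<bullet> z) / 2)"
    by (simp add: fun_eq_iff diag_form_def L_def inner_vec_def sum_divide_distrib
        power2_norm_eq_inner)
  define D where "D z = blinfun_inner_right (L z)" for z
  have D: "bounded_linear D"
    unfolding D_def by (rule bounded_linear_compose[OF bounded_linear_blinfun_inner_right L])
  have "(diag_form a has_derivative blinfun_apply (D z)) (at z)" for z
    unfolding form D_def
    by (rule derivative_eq_intros bounded_linear_imp_has_derivative[OF L] refl)+
       (simp_all add: fun_eq_iff sym)
  moreover have "(D has_derivative blinfun_apply (Blinfun D)) (at z)" for z
    by (simp add: bounded_linear_Blinfun_apply[OF D] bounded_linear_imp_has_derivative[OF D])
  ultimately show ?thesis
    unfolding C2_on_def by (intro exI[of _ D] exI[of _ "\<lambda>_. Blinfun D"]) auto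
qed

lemma dir_deriv_diag_form:
  "dir_deriv v (\<lambda>w. complex_of_real (diag_form a w)) z =
     complex_of_real (\<Sum>p\<in>UNIV. 2 * a p * (z $ p \<bullet> v $ p))"
proof -
  have "((\<lambda>t. diag_form a (z + t *\<^sub>R v)) has_real_derivative
          (\<Sum>p\<in>UNIV. 2 * a p * (z $ p \<bullet> v $ p))) (at 0)"
    unfolding diag_form_def cmod_power2
    by (auto intro!: derivative_eq_intros sum.cong simp: inner_complex_def algebra_simps)
  from has_vector_derivative_of_real[OF this]
  show ?thesis
    unfolding dir_deriv_def by (rule vector_derivative_at)
qed

text \<open>
  The directional derivatives along \<open>1\<close> and \<open>\<i>\<close> in the coordinate \<open>q\<close> are \<open>2 a\<^sub>q\<close> times the real
  and the imaginary part of \<open>z\<^sub>q\<close>; the Wirtinger operator recombines them into \<open>z\<^sub>q\<close> itself.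
\<close>

lemma wirtinger_bar_diag_form:
  "wirtinger_bar q (\<lambda>w. complex_of_real (diag_form a w)) = (\<lambda>z. complex_of_real (a q) * z $ q)"
proof
  fix z :: "complex^'a"
  have *: "(\<Sum>p\<in>UNIV. 2 * a p * (z $ p \<bullet> axis q c $ p)) = 2 * a q * (z $ q \<bullet> c)" for c
    by (subst sum.remove[of _ q]) (auto simp: axis_def)
  show "wirtinger_bar q (\<lambda>w. complex_of_real (diag_form a w)) z = complex_of_real (a q) * z $ q"
    unfolding wirtinger_bar_def dir_deriv_diag_form *
    by (simp add: complex_eq_iff inner_complex_def)
qed

lemma dir_deriv_linear: "dir_deriv v (\<lambda>z. c * z $ q) z = c * v $ q"
  unfolding dir_deriv_def
  by (rule vector_derivative_at) (auto intro!: derivative_eq_intros simp: algebra_simps)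

lemma complex_hessian_diag_form:
  "complex_hessian (diag_form a) z = (\<chi> p q. if p = q then complex_of_real (a q) else 0)"
  by (simp add: complex_hessian_def wirtinger_bar_diag_form wirtinger_def dir_deriv_linear
      vec_eq_iff) (auto simp: axis_def algebra_simps)

lemma proots_prod_linear_factors:
  assumes "finite A"
  shows "proots (\<Prod>i\<in>A. [:- d i, 1:]) = image_mset d (mset_set A)"
  using assms by induction
    (simp_all add: proots_mult prod_zero_iff del: mult_pCons_left mult_pCons_right)

lemma proots_charpoly_diag:
  "proots (charpoly (\<chi> p q. if p = q then d q else 0)) =
     image_mset d (mset_set (UNIV::'n::finite set))"
proof -
  have "charpoly (\<chi> p q. if p = q then d q else 0) = (\<Prod>i\<in>UNIV. [:- d i, 1:])"
    unfolding charpoly_def by (subst det_diagonal) auto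
  then show ?thesis
    by (simp add: proots_prod_linear_factors)
qed

text \<open>
  The eigenvalue list is determined by its multiset, so the weights may be listed along any
  enumeration of the index type that makes them increasing.
\<close>

lemma hermitian_eigenvalues_diag_form:
  fixes a :: "'n::finite \<Rightarrow> real"
  assumes "sorted xs" "mset xs = image_mset a (mset_set UNIV)"
  shows "hermitian_eigenvalues (complex_hessian (diag_form a) z) = xs"
proof -
  have "hermitian_eigenvalues (complex_hessian (diag_form a) z) = sorted_list_of_multiset (mset xs)"
    by (simp add: hermitian_eigenvalues_def complex_hessian_diag_form proots_charpoly_diag
        assms(2) multiset.map_comp o_def)
  also have "\<dots> = sort xs"
    by simp
  finally show ?thesis
    using assms(1) by (simp add: sorted_sort_id)
qed

lemma prod_monom:
  fixes x :: "'a \<Rightarrow> 'b::comm_semiring_1"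
  shows "(\<Prod>i\<in>S. monom (x i) 1) = monom (\<Prod>i\<in>S. x i) (card S)"
  by (induction S rule: infinite_finite_induct) (simp_all add: mult_monom)

text \<open>
  Expanding the product chooses a subset of the factors that contribute their linear terms. The
  generating polynomial replaces a sum over subsets by a product, in which equal factors can be
  collected into powers.
\<close>

lemma elem_sym_eq_coeff: "elem_sym n j x = coeff (\<Prod>i\<in>{1..n}. [:1, x i:]) j"
proof -
  have "(\<Prod>i\<in>{1..n}. [:1, x i:]) = (\<Prod>i\<in>{1..n}. monom (x i) 1 + 1)"
    by (simp add: monom_altdef one_pCons)
  also have "\<dots> = (\<Sum>S\<in>Pow {1..n}. \<Prod>i\<in>S. monom (x i) 1)"
    by (subst prod_add) simp_all
  also have "\<dots> = (\<Sum>S\<in>Pow {1..n}. monom (\<Prod>i\<in>S. x i) (card S))"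
    by (intro sum.cong refl) (simp only: prod_monom prod.neutral_const mult_1_right)
  also have "coeff \<dots> j = (\<Sum>S\<in>Pow {1..n}. if card S = j then \<Prod>i\<in>S. x i else 0)"
    by (simp add: coeff_sum)
  also have "\<dots> = elem_sym n j x"
    unfolding elem_sym_def by (subst sum.inter_filter[symmetric]) (auto intro!: sum.cong)
  finally show ?thesis ..
qed

lemma elem_sym_11:
  assumes "\<And>i. i \<in> {1..11} \<Longrightarrow> x i = (if i \<le> 2 then -1 else 2)"
  shows "elem_sym 11 9 x = 512" "elem_sym 11 8 x = -1536"
proof -
  have "(\<Prod>i\<in>{1..11}. [:1, x i:]) = (\<Prod>i\<in>{1..11::nat}. if i \<le> 2 then [:1, -1:] else [:1, 2::real:])"
    by (intro prod.cong refl) (simp add: assms)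
  also have "\<dots> = [:1, -1:] ^ 2 * [:1, 2:] ^ 9"
  proof -
    have "{1..11} \<inter> {i::nat. i \<le> 2} = {1..2}" "{1..11} \<inter> - {i::nat. i \<le> 2} = {3..11}"
      by auto
    then show ?thesis
      by (simp add: prod.If_cases)
  qed
  also have "[:1, -1::real:] ^ 2 = [:1, -2, 1:]"
    by (simp add: power2_eq_square)
  finally have *: "elem_sym 11 j x = coeff ([:1, -2, 1:] * [:1, 2:] ^ 9) j" for j
    by (simp add: elem_sym_eq_coeff)
  have choose: "9 choose 6 = (84::nat)" "9 choose 7 = (36::nat)" "9 choose 8 = (9::nat)"
    by code_simp+
  show "elem_sym 11 9 x = 512" "elem_sym 11 8 x = -1536"
    unfolding *
    by (simp_all add: coeff_pCons' coeff_linear_poly_power choose)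
qed

theorem mainTheorem2:
  fixes u :: "complex^11 \<Rightarrow> real"
  assumes "\<And>z. u z = - (\<Sum>j::nat = 1..2. (cmod (z $ of_nat j))\<^sup>2)
                     + 2 * (\<Sum>j::nat = 3..11. (cmod (z $ of_nat j))\<^sup>2)"
  shows "form_kk_nonneg UNIV 3 u \<and>
         form_top_nonneg UNIV 9 u \<and>
         form_top_neg UNIV 8 u \<and>
         A_subharmonic UNIV 3 u \<and>
         \<not> B_subharmonic UNIV 3 u"
proof -
  \<comment> \<open>The eigenvalues in increasing order; coordinate \<open>j\<close> carries the weight \<open>c j\<close>.\<close>
  define c :: "nat \<Rightarrow> real" where "c j = (if j \<le> 2 then -1 else 2)" for j
  define a :: "11 \<Rightarrow> real" where "a = c \<circ> the_inv_into {1..11} of_nat"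
  have a: "a (of_nat j) = c j" if "j \<in> {1..11}" for j
    using that bij_betw_imp_inj_on[OF bij_betw_of_nat_11] by (simp add: a_def the_inv_into_f_f)
  have split: "{1..11} = {1..2} \<union> {3..11::nat}"
    by auto
  have "u z = diag_form a z" for z
  proof -
    have "diag_form a z = (\<Sum>j\<in>{1..11}. c j * (cmod (z $ of_nat j))\<^sup>2)"
      unfolding diag_form_def sum.reindex_bij_betw[OF bij_betw_of_nat_11, symmetric]
      by (intro sum.cong refl) (simp only: a)
    also have "\<dots> = u z"
      unfolding split assms
      by (subst sum.union_disjoint) (auto simp: c_def sum_distrib_left sum_negf[symmetric])
    finally show ?thesis ..
  qed
  then have u: "u = diag_form a" ..
  have ev: "hessian_eigenvalue u i z = c i" if "i \<in> {1..11}" for i z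
  proof -
    have "image_mset a (mset_set UNIV) = image_mset a (image_mset of_nat (mset_set {1..11::nat}))"
      using bij_betw_of_nat_11 by (simp add: image_mset_mset_set bij_betw_def)
    also have "\<dots> = image_mset c (mset_set {1..11})"
      unfolding multiset.map_comp by (intro image_mset_cong) (auto simp: a)
    also have "\<dots> = mset (map c [1..<12])"
      by (simp add: atLeastLessThanSuc_atLeastAtMost[symmetric])
    finally have "hermitian_eigenvalues (complex_hessian u z) = map c [1..<12]"
      unfolding u by (intro hermitian_eigenvalues_diag_form)
        (auto simp: sorted_map sorted_wrt_iff_nth_less c_def)
    with that show ?thesis
      by (auto simp: hessian_eigenvalue_def)
  qed
  have "0 \<le> (\<Sum>j\<in>S. hessian_eigenvalue u j z)" if S: "S \<subseteq> {1..11}" "card S = 3" for S z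
  proof -
    have "finite S"
      using S finite_subset by blast
    \<comment> \<open>Three indices cannot all lie among the two that carry the weight \<open>-1\<close>.\<close>
    have "\<not> S \<subseteq> {1..2}"
      using card_mono[of "{1..2}" S] S by auto
    then obtain k where k: "k \<in> S" "k \<notin> {1..2}"
      by blast
    have "(\<Sum>j\<in>S. hessian_eigenvalue u j z) = (\<Sum>j\<in>S. c j)"
      using S by (intro sum.cong) (auto simp: ev)
    also have "\<dots> = c k + (\<Sum>j\<in>S - {k}. c j)"
      using \<open>finite S\<close> k by (intro sum.remove)
    also have "\<dots> \<ge> 2 + of_nat (card (S - {k})) * (-1)"
      using k S by (intro add_mono sum_bounded_below) (auto simp: c_def)
    finally show ?thesis
      using S k \<open>finite S\<close> by simp
  qed
  then have kk: "form_kk_nonneg UNIV 3 u"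
    by (simp add: form_kk_nonneg_def)
  have \<sigma>: "elem_sym 11 9 (\<lambda>i. hessian_eigenvalue u i z) = 512"
    "elem_sym 11 8 (\<lambda>i. hessian_eigenvalue u i z) = -1536" for z
    by (rule elem_sym_11; simp add: ev c_def)+
  have top: "form_top_nonneg UNIV 9 u" "form_top_neg UNIV 8 u"
    by (simp_all add: form_top_nonneg_def form_top_neg_def \<sigma>)
  moreover have "A_subharmonic UNIV 3 u"
    using kk top by (simp add: A_subharmonic_def k_plurisubharmonic_def u C2_on_diag_form)
  moreover have "\<not> form_top_nonneg UNIV 8 u"
    by (simp add: form_top_nonneg_def \<sigma>)
  then have "\<not> B_subharmonic UNIV 3 u"
    by (auto simp: B_subharmonic_def)
  ultimately show ?thesis
    using kk by blast
qed

end
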